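(* Let $\Omega=S^1$, let $\mathbb{P}$ be a Borel probability measure on $\Omega$ with full support, and let $\sigma:\Omega\to\Omega$ be an invertible ergodic $\mathbb{P}$-preserving transformation. Let $n\ge 2$ be an integer and let $\mathcal{T}_{(\rho,\zeta)}$ be a Blaschke product cocycle of degree $n$ over $\sigma$ fixing the origin, where $\zeta=(0,\zeta_2,\dots,\zeta_n):\Omega\to\{0\}\times D_1^{n-1}$ is continuously differentiable. For $\lambda\in D_1$ let $\mathcal{T}_{(\rho,\zeta)}^\lambda$ be the perturbed cocycle with the same $\rho$ and with $\zeta$ replaced by $\zeta^\lambda=(0,\zeta_2^\lambda,\dots,\zeta_n^\lambda)$, where $$\zeta_{i,\omega}^\lambda=\Phi^{-1}(\Phi(\zeta_{i,\omega})+\Phi(\lambda)),\qquad i=2,\dots,n.$$ Then for Lebesgue-almost every $\lambda\in D_1$ the cocycle $\mathcal{T}_{(\rho,\zeta)}^\lambda$ is stable; that is, $$\mathrm{Leb}\left(\left\{\lambda\in D_1 : \mathcal{T}_{(\rho,\zeta)}^\lambda\text{ is unstable}\right\}\right)=0.$$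
   Context: $D_1=\{z\in\mathbb{C}:|z|<1\}$; $C^1$ is meant in the real sense. $\mathbb{P}$ has full support if every nonempty open set has positive measure. $\Phi:D_1\to\mathbb{C}$ is $\Phi(z)=z/\sqrt{1-|z|^2}$, a bijection with inverse $\Phi^{-1}(z)=z/\sqrt{1+|z|^2}$. Given measurable $\rho:\Omega\to S^1$ and measurable $\zeta=(0,\zeta_2,\dots,\zeta_n):\Omega\to\{0\}\times D_1^{n-1}$, the Blaschke product cocycle of degree $n$ fixing the origin $\mathcal{T}_{(\rho,\zeta)}=(T_\omega)_{\omega\in\Omega}$ over $\sigma$ is given by $T_\omega(z)=\rho_\omega z\prod_{i=2}^n\frac{z-\zeta_{i,\omega}}{1-\overline{\zeta_{i,\omega}}\,z}$. Its random fixed point is $x_\omega=0$. Stability: the cocycle is called stable if $\operatorname{ess\,inf}_{\omega\in\Omega}|T_\omega'(x_\omega)|>0$ and unstable if $\operatorname{ess\,inf}_{\omega\in\Omega}|T_\omega'(x_\omega)|=0$ (essential infimum with respect to $\mathbb{P}$, and $x_\omega=0$). *)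

theory Defs
  imports "HOL-Probability.Probability"
begin

definition full_support :: "'a::topological_space measure \<Rightarrow> bool" where
  "full_support M \<longleftrightarrow>
     (\<forall>U. openin (top_of_set (space M)) U \<and> U \<noteq> {} \<longrightarrow> 0 < emeasure M U)"

definition invertible_transformation :: "'a measure \<Rightarrow> ('a \<Rightarrow> 'a) \<Rightarrow> bool" where
  "invertible_transformation M \<sigma> \<longleftrightarrow>
     bij_betw \<sigma> (space M) (space M) \<and> \<sigma> \<in> measurable M M \<and>
     the_inv_into (space M) \<sigma> \<in> measurable M M"

definition measure_preserving_transformation :: "'a measure \<Rightarrow> ('a \<Rightarrow> 'a) \<Rightarrow> bool" where
  "measure_preserving_transformation M \<sigma> \<longleftrightarrow>
     \<sigma> \<in> measurable M M \<and> (\<forall>A\<in>sets M. emeasure M (\<sigma> -` A \<inter> space M) = emeasure M A)"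

definition ergodic_transformation :: "'a measure \<Rightarrow> ('a \<Rightarrow> 'a) \<Rightarrow> bool" where
  "ergodic_transformation M \<sigma> \<longleftrightarrow>
     measure_preserving_transformation M \<sigma> \<and>
     (\<forall>A\<in>sets M. \<sigma> -` A \<inter> space M = A \<longrightarrow> emeasure M A = 0 \<or> emeasure M A = 1)"

text \<open>The parameter \<open>\<zeta> = (0, \<zeta>\<^sub>2, \<dots>, \<zeta>\<^sub>n)\<close> is represented by its components
  \<open>\<zeta> i\<close> for \<open>i \<in> {2..n}\<close>; the constant first component accounts for the factor \<open>z\<close> in
  \<open>blaschke_cocycle\<close>, and values of \<open>\<zeta>\<close> at other indices are never used.\<close>

definition blaschke_parameters ::
  "'a measure \<Rightarrow> nat \<Rightarrow> ('a \<Rightarrow> complex) \<Rightarrow> (nat \<Rightarrow> 'a \<Rightarrow> complex) \<Rightarrow> bool" where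
  "blaschke_parameters M n \<rho> \<zeta> \<longleftrightarrow>
     \<rho> \<in> measurable M (restrict_space borel (sphere 0 1)) \<and>
     (\<forall>i\<in>{2..n}. \<zeta> i \<in> measurable M (restrict_space borel (ball 0 1)))"

definition blaschke_cocycle ::
  "nat \<Rightarrow> ('a \<Rightarrow> complex) \<Rightarrow> (nat \<Rightarrow> 'a \<Rightarrow> complex) \<Rightarrow> 'a \<Rightarrow> complex \<Rightarrow> complex" where
  "blaschke_cocycle n \<rho> \<zeta> \<omega> z =
     \<rho> \<omega> * z * (\<Prod>i=2..n. (z - \<zeta> i \<omega>) / (1 - cnj (\<zeta> i \<omega>) * z))"

definition essinf :: "'a measure \<Rightarrow> ('a \<Rightarrow> real) \<Rightarrow> ereal" where
  "essinf M f = - esssup M (\<lambda>\<omega>. - ereal (f \<omega>))"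

text \<open>Here \<open>x\<close> is the random fixed point of the cocycle \<open>T\<close>.\<close>

definition stable_cocycle ::
  "'a measure \<Rightarrow> ('a \<Rightarrow> complex \<Rightarrow> complex) \<Rightarrow> ('a \<Rightarrow> complex) \<Rightarrow> bool" where
  "stable_cocycle M T x \<longleftrightarrow> essinf M (\<lambda>\<omega>. cmod (deriv (T \<omega>) (x \<omega>))) > 0"

definition unstable_cocycle ::
  "'a measure \<Rightarrow> ('a \<Rightarrow> complex \<Rightarrow> complex) \<Rightarrow> ('a \<Rightarrow> complex) \<Rightarrow> bool" where
  "unstable_cocycle M T x \<longleftrightarrow> essinf M (\<lambda>\<omega>. cmod (deriv (T \<omega>) (x \<omega>))) = 0"

definition Phi :: "complex \<Rightarrow> complex" where
  "Phi z = z / complex_of_real (sqrt (1 - (cmod z)\<^sup>2))"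

definition Phi_inv :: "complex \<Rightarrow> complex" where
  "Phi_inv z = z / complex_of_real (sqrt (1 + (cmod z)\<^sup>2))"

lemma Phi_inv_in_ball: "Phi_inv w \<in> ball 0 1"
proof -
  have "sqrt ((cmod w)\<^sup>2) < sqrt (1 + (cmod w)\<^sup>2)"
    by (intro real_sqrt_less_mono) simp
  then have "cmod w < sqrt (1 + (cmod w)\<^sup>2)" by simp
  moreover have "0 < sqrt (1 + (cmod w)\<^sup>2)"
    by (simp add: add_pos_nonneg)
  ultimately show ?thesis
    by (simp add: Phi_inv_def norm_divide divide_simps)
qed

lemma Phi_inv_Phi:
  assumes "z \<in> ball 0 1" shows "Phi_inv (Phi z) = z"
proof -
  define s where "s = 1 - (cmod z)\<^sup>2"
  have s: "s > 0" using assms by (simp add: s_def power_less_one_iff)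
  have "(cmod (Phi z))\<^sup>2 = (cmod z)\<^sup>2 / s"
    using s by (simp add: Phi_def norm_divide power_divide flip: s_def)
  then have "1 + (cmod (Phi z))\<^sup>2 = 1 / s"
    using s by (simp add: s_def divide_simps) (simp add: algebra_simps)
  then show ?thesis
    using s by (simp add: Phi_inv_def real_sqrt_divide) (simp add: Phi_def flip: s_def)
qed

lemma Phi_Phi_inv: "Phi (Phi_inv w) = w"
proof -
  define s where "s = 1 + (cmod w)\<^sup>2"
  have s: "s > 0" by (simp add: s_def add_pos_nonneg)
  have "(cmod (Phi_inv w))\<^sup>2 = (cmod w)\<^sup>2 / s"
    using s by (simp add: Phi_inv_def norm_divide power_divide flip: s_def)
  then have "1 - (cmod (Phi_inv w))\<^sup>2 = 1 / s"
    using s by (simp add: s_def divide_simps) (simp add: algebra_simps)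
  then show ?thesis
    using s by (simp add: Phi_def real_sqrt_divide) (simp add: Phi_inv_def flip: s_def)
qed

lemma bij_betw_Phi: "bij_betw Phi (ball 0 1) UNIV"
  by (rule bij_betw_byWitness[where f' = Phi_inv])
     (use Phi_inv_Phi Phi_Phi_inv Phi_inv_in_ball in auto)

definition perturbed :: "complex \<Rightarrow> (nat \<Rightarrow> 'a \<Rightarrow> complex) \<Rightarrow> nat \<Rightarrow> 'a \<Rightarrow> complex" where
  "perturbed l \<zeta> i \<omega> = Phi_inv (Phi (\<zeta> i \<omega>) + Phi l)"

text \<open>A function on the unit circle is \<open>C\<^sup>1\<close> iff its lift under the covering \<open>t \<mapsto> cis t\<close>, a
  local diffeomorphism from the reals onto the circle, is \<open>C\<^sup>1\<close>.\<close>

definition C1_on_circle :: "(complex \<Rightarrow> complex) \<Rightarrow> bool" where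
  "C1_on_circle f \<longleftrightarrow> (\<lambda>t::real. f (cis t)) C1_differentiable_on UNIV"

end

theory Submission
  imports Defs
begin

text \<open>The derivative at the fixed point has modulus \<open>\<Prod>\<^sub>i |\<zeta>\<^sub>i\<^sup>\<lambda>|\<close>, and \<open>\<zeta>\<^sub>i\<^sup>\<lambda>\<close> vanishes at \<open>\<omega>\<close> exactly
  when \<open>\<lambda> = - \<zeta>\<^sub>i(\<omega>)\<close>, because \<open>\<Phi>\<close> is odd and injective. Off the reflected curves \<open>- \<zeta>\<^sub>i(S\<^sup>1)\<close>,
  which are planar null sets as \<open>C\<^sup>1\<close> images of the line, the product is therefore
  bounded away from zero by compactness of the circle.\<close>

lemma Phi_inv_eq_0_iff: "Phi_inv w = 0 \<longleftrightarrow> w = 0"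
  by (metis Phi_Phi_inv Phi_def div_0 Phi_inv_def)

lemma Phi_minus: "Phi (- z) = - Phi z"
  by (simp add: Phi_def)

lemma perturbed_eq_0_iff:
  assumes "\<zeta> i \<omega> \<in> ball 0 1" "l \<in> ball 0 1"
  shows "perturbed l \<zeta> i \<omega> = 0 \<longleftrightarrow> l = - \<zeta> i \<omega>"
proof -
  have "Phi (\<zeta> i \<omega>) + Phi l = 0 \<longleftrightarrow> Phi l = Phi (- \<zeta> i \<omega>)"
    by (auto simp: Phi_minus add_eq_0_iff)
  also have "\<dots> \<longleftrightarrow> l = - \<zeta> i \<omega>"
    using bij_betw_imp_inj_on[OF bij_betw_Phi] assms by (auto simp: inj_on_eq_iff)
  finally show ?thesis
    by (simp add: perturbed_def Phi_inv_eq_0_iff)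
qed

lemma continuous_on_Phi: "continuous_on (ball 0 1) Phi"
proof -
  have "(cmod z)\<^sup>2 < 1" if "z \<in> ball 0 1" for z
    using that by (simp add: abs_square_less_1)
  then show ?thesis
    unfolding Phi_def by (intro continuous_intros) force
qed

lemma continuous_on_Phi_inv: "continuous_on UNIV Phi_inv"
proof -
  have "1 + (cmod z)\<^sup>2 \<noteq> 0" for z
    by (smt (verit) zero_le_power2)
  then show ?thesis
    unfolding Phi_inv_def by (intro continuous_intros) auto
qed

text \<open>Since \<open>sqrt\<close> and division are total, measurability holds on the whole
  plane, including points outside the disc; composing with \<open>\<zeta> i\<close> then needs no
  restricted domain.\<close>

lemma borel_measurable_Phi [measurable]: "Phi \<in> borel_measurable borel"
  unfolding Phi_def by measurable

lemma borel_measurable_Phi_inv [measurable]: "Phi_inv \<in> borel_measurable borel"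
  unfolding Phi_inv_def by measurable

text \<open>Caratheodory's criterion avoids differentiating the product: the map is \<open>z\<close>
  times a factor \<open>?g\<close> continuous at 0, so its derivative there is
  \<open>?g 0\<close>.\<close>

lemma cmod_deriv_blaschke_cocycle_0:
  "cmod (deriv (blaschke_cocycle n \<rho> \<zeta> \<omega>) 0) = cmod (\<rho> \<omega>) * (\<Prod>i=2..n. cmod (\<zeta> i \<omega>))"
proof -
  let ?T = "blaschke_cocycle n \<rho> \<zeta> \<omega>"
  let ?g = "\<lambda>z. \<rho> \<omega> * (\<Prod>i=2..n. (z - \<zeta> i \<omega>) / (1 - cnj (\<zeta> i \<omega>) * z))"
  have "\<forall>z. ?T z - ?T 0 = ?g z * (z - 0)"
    by (simp add: blaschke_cocycle_def)
  moreover have "isCont ?g 0"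
    by (intro continuous_intros) auto
  ultimately have "(?T has_field_derivative ?g 0) (at 0)"
    unfolding CARAT_DERIV by (intro exI[of _ ?g]) simp
  then have "deriv ?T 0 = ?g 0"
    by (rule DERIV_imp_deriv)
  then show ?thesis
    by (simp add: norm_mult flip: prod_norm)
qed

lemma cis_Arg_sphere: "\<omega> \<in> sphere 0 1 \<Longrightarrow> cis (Arg \<omega>) = \<omega>"
  by (subst cis_Arg) (auto simp: sgn_div_norm)

text \<open>The lift along \<open>cis\<close> is a differentiable map from a one-dimensional space
  to a two-dimensional one, so its range is null.\<close>

lemma negligible_circle_curve:
  assumes "C1_on_circle f"
  shows "negligible (f ` sphere 0 1)"
proof -
  have "(\<lambda>t. f (cis t)) differentiable_on UNIV"
    using assms unfolding C1_on_circle_def by (rule C1_diff_imp_diff)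
  then have "negligible (range (\<lambda>t::real. f (cis t)))"
    by (intro negligible_differentiable_image_lowdim) auto
  moreover have "f ` sphere 0 1 \<subseteq> range (\<lambda>t. f (cis t))"
    using cis_Arg_sphere by (metis image_subsetI rangeI)
  ultimately show ?thesis
    by (rule negligible_subset)
qed

text \<open>Smoothness is given only for the lift, so the minimum is taken over the compact interval
  from \<open>- pi\<close> to \<open>pi\<close>, which contains every value of
  \<open>Arg\<close>.\<close>

lemma perturbed_bounded_below:
  assumes C1: "C1_on_circle (\<zeta> i)"
    and ball: "\<And>\<omega>. \<omega> \<in> sphere 0 1 \<Longrightarrow> \<zeta> i \<omega> \<in> ball 0 1"
    and l: "l \<in> ball 0 1" "l \<notin> (\<lambda>\<omega>. - \<zeta> i \<omega>) ` sphere 0 1"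
  shows "\<exists>c>0. \<forall>\<omega>\<in>sphere 0 1. c \<le> cmod (perturbed l \<zeta> i \<omega>)"
proof -
  let ?h = "\<lambda>t. cmod (perturbed l \<zeta> i (cis t))"
  have "continuous_on {- pi..pi} (\<lambda>t. \<zeta> i (cis t))"
    using C1_differentiable_imp_continuous_on C1 continuous_on_subset
    unfolding C1_on_circle_def by blast
  then have "continuous_on {- pi..pi} (\<lambda>t. Phi (\<zeta> i (cis t)))"
    by (rule continuous_on_compose2[OF continuous_on_Phi]) (use ball in auto)
  then have "continuous_on {- pi..pi} (\<lambda>t. Phi (\<zeta> i (cis t)) + Phi l)"
    by (intro continuous_intros)
  then have "continuous_on {- pi..pi} ?h"
    unfolding perturbed_def
    by (intro continuous_on_norm continuous_on_compose2[OF continuous_on_Phi_inv]) auto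
  then obtain t0 where min: "\<And>t. t \<in> {- pi..pi} \<Longrightarrow> ?h t0 \<le> ?h t"
    using continuous_attains_inf[of "{- pi..pi}" ?h] by force
  \<comment> \<open>A zero of \<open>?h\<close> at \<open>t0\<close> would place \<open>l\<close> on
    the reflected curve, at the point with parameter \<open>cis t0\<close>.\<close>
  have "?h t0 > 0"
    using l ball[of "cis t0"] by (auto simp: perturbed_eq_0_iff)
  moreover have "?h t0 \<le> cmod (perturbed l \<zeta> i \<omega>)" if "\<omega> \<in> sphere 0 1" for \<omega>
    using min[of "Arg \<omega>"] Arg_bounded[of \<omega>] that by (auto simp: cis_Arg_sphere)
  ultimately show ?thesis by blast
qed

text \<open>Measurability matters here: \<open>esssup\<close> takes the value top on nonmeasurable
  functions, which would make \<open>essinf\<close> minus infinity.\<close>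

lemma essinf_geI:
  assumes "f \<in> borel_measurable M" "AE x in M. c \<le> f x"
  shows "ereal c \<le> essinf M f"
proof -
  have "esssup M (\<lambda>x. - ereal (f x)) \<le> - ereal c"
    using assms by (intro esssup_I) auto
  then show ?thesis
    unfolding essinf_def by (subst ereal_minus_le_minus[symmetric]) simp
qed

theorem theorem7p4:
  fixes P :: "complex measure" and \<sigma> \<rho> :: "complex \<Rightarrow> complex"
    and \<zeta> :: "nat \<Rightarrow> complex \<Rightarrow> complex" and n :: nat
  assumes "prob_space P"
    and "sets P = sets (restrict_space borel (sphere 0 1))"
    and "full_support P"
    and "invertible_transformation P \<sigma>"
    and "ergodic_transformation P \<sigma>"
    and "n \<ge> 2"
    and "blaschke_parameters P n \<rho> \<zeta>"
    and "\<And>i. i \<in> {2..n} \<Longrightarrow> C1_on_circle (\<zeta> i)"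
  shows "(AE l in lebesgue. l \<in> ball 0 1 \<longrightarrow>
            stable_cocycle P (blaschke_cocycle n \<rho> (perturbed l \<zeta>)) (\<lambda>_. 0)) \<and>
         {l \<in> ball 0 1. unstable_cocycle P (blaschke_cocycle n \<rho> (perturbed l \<zeta>)) (\<lambda>_. 0)}
           \<in> null_sets lebesgue"
proof -
  have space: "space P = sphere 0 1"
    using sets_eq_imp_space_eq[OF assms(2)] by (simp add: space_restrict_space)
  note restr = measurable_restrict_space2_iff Pi_iff space
  have rho: "\<rho> \<in> borel_measurable P" "\<And>\<omega>. \<omega> \<in> sphere 0 1 \<Longrightarrow> cmod (\<rho> \<omega>) = 1"
    using assms(7) unfolding blaschke_parameters_def restr by simp_all
  have zeta: "\<zeta> i \<in> borel_measurable P" "\<And>\<omega>. \<omega> \<in> sphere 0 1 \<Longrightarrow> \<zeta> i \<omega> \<in> ball 0 1"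
    if "i \<in> {2..n}" for i
    using assms(7) that unfolding blaschke_parameters_def restr by simp_all
  \<comment> \<open>The exceptional parameters: outside \<open>N\<close>, no perturbed zero hits the
    origin for any \<open>\<omega>\<close> on the circle.\<close>
  define N where "N = (\<Union>i\<in>{2..n}. (\<lambda>\<omega>. - \<zeta> i \<omega>) ` sphere 0 1)"
  have "negligible ((\<lambda>\<omega>. - \<zeta> i \<omega>) ` sphere 0 1)" if "i \<in> {2..n}" for i
    using assms(8)[OF that]
    by (intro negligible_circle_curve) (simp add: C1_on_circle_def)
  then have "negligible N"
    unfolding N_def by (intro negligible_Union) auto
  then have N: "N \<in> null_sets lebesgue"
    by (simp add: negligible_iff_null_sets)
  have stable: "stable_cocycle P (blaschke_cocycle n \<rho> (perturbed l \<zeta>)) (\<lambda>_. 0)"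
    if l: "l \<in> ball 0 1" "l \<notin> N" for l
  proof -
    let ?d = "\<lambda>\<omega>. cmod (deriv (blaschke_cocycle n \<rho> (perturbed l \<zeta>) \<omega>) 0)"
    have "\<exists>c>0. \<forall>\<omega>\<in>sphere 0 1. c \<le> cmod (perturbed l \<zeta> i \<omega>)" if "i \<in> {2..n}" for i
      using l that zeta(2)[OF that] assms(8)[OF that]
      by (intro perturbed_bounded_below) (auto simp: N_def)
    \<comment> \<open>Each \<open>c i\<close> is uniform in \<open>\<omega>\<close>, so the finite
      product of these constants bounds the derivative from below, as \<open>\<rho>\<close> has
      modulus 1.\<close>
    then obtain c where c: "\<And>i. i \<in> {2..n} \<Longrightarrow> c i > 0"
      "\<And>i \<omega>. i \<in> {2..n} \<Longrightarrow> \<omega> \<in> sphere 0 1 \<Longrightarrow> c i \<le> cmod (perturbed l \<zeta> i \<omega>)"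
      by metis
    have "perturbed l \<zeta> i \<in> borel_measurable P" if "i \<in> {2..n}" for i
      using zeta(1)[OF that] unfolding perturbed_def by measurable
    then have "?d \<in> borel_measurable P"
      unfolding cmod_deriv_blaschke_cocycle_0
      by (intro borel_measurable_times borel_measurable_prod
          measurable_compose[OF _ borel_measurable_norm] rho)
    moreover have "(\<Prod>i=2..n. c i) \<le> ?d \<omega>" if "\<omega> \<in> space P" for \<omega>
      using that c rho(2)[of \<omega>]
      by (auto simp: cmod_deriv_blaschke_cocycle_0 space less_imp_le intro!: prod_mono)
    ultimately have "ereal (\<Prod>i=2..n. c i) \<le> essinf P ?d"
      by (intro essinf_geI AE_I2)
    moreover have "0 < (\<Prod>i=2..n. c i)"
      using c(1) by (intro prod_pos) auto
    ultimately show ?thesis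
      unfolding stable_cocycle_def by (metis ereal_less(2) less_le_trans)
  qed
  have "AE l in lebesgue. l \<in> ball 0 1 \<longrightarrow>
      stable_cocycle P (blaschke_cocycle n \<rho> (perturbed l \<zeta>)) (\<lambda>_. 0)"
    using AE_not_in[OF N] by eventually_elim (use stable in blast)
  moreover have "{l \<in> ball 0 1. unstable_cocycle P (blaschke_cocycle n \<rho> (perturbed l \<zeta>)) (\<lambda>_. 0)} \<subseteq> N"
    using stable by (force simp: stable_cocycle_def unstable_cocycle_def)
  \<comment> \<open>Completeness of Lebesgue measure makes the unstable set measurable, as a subset
    of the null set \<open>N\<close>.\<close>
  then have "{l \<in> ball 0 1. unstable_cocycle P (blaschke_cocycle n \<rho> (perturbed l \<zeta>)) (\<lambda>_. 0)}
      \<in> null_sets lebesgue"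
    by (rule null_sets_completion_subset[OF _ N])
  ultimately show ?thesis ..
qed

end
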